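(* Let $n\equiv3\pmod4$, $n\ge7$, and put $m=\frac{n+1}{2}$ (an even integer). For $X\in M_n(\mathbb{C})$ let $\tilde X=\begin{pmatrix}0&0\\ 0&X\end{pmatrix}\in M_{n+1}(\mathbb{C})$ be $X$ padded with a zero first row and a zero first column, viewed as an $m\times m$ matrix of $2\times2$ blocks $\tilde X_{(p,q)}$, $1\le p,q\le m$. The solutions $X$ of $X^tA_n^2+A_n^2X=0$ are exactly those $X$ for which $\tilde X$ has the following form, for arbitrary complex parameters $x_{1,1},x_{2,1},x_{2,2},x_{2,3},x_{2,4},x_{2,5}$, $x_{1,i},x_{1,i+1}$ ($i=4+4k$, $0\le k\le\frac{n-7}{4}$), $x_{2,j},x_{2,j+1}$ ($j=8+4k$, $0\le k\le\frac{n-11}{4}$): putting $$X_{11}=\begin{pmatrix}0&0\\ 0&x_{1,1}\end{pmatrix},\ X_{21}=\begin{pmatrix}0&x_{2,1}\\ 0&0\end{pmatrix},\ X_{2,2}=\begin{pmatrix}x_{2,2}&x_{2,3}\\ 0&-x_{1,1}\end{pmatrix},\ Z_{2,4}=\begin{pmatrix}x_{2,4}&x_{2,5}\\ -x_{2,1}&0\end{pmatrix},$$ $$Y_{1,i}=\begin{pmatrix}0&0\\ x_{1,i}&x_{1,i+1}\end{pmatrix},\quad Y_{2,j}=\begin{pmatrix}x_{2,j}&x_{2,j+1}\\ 0&0\end{pmatrix},$$ one has - $\tilde X_{(1,1)}=X_{11}$; $\tilde X_{(2,1)}=X_{21}$; $\tilde X_{(p,p)}=X_{2,2}$ for $p$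 even; $\tilde X_{(p,p)}=-X_{2,2}^t$ for $p\ge3$ odd; - $\tilde X_{(p,q)}=Y_{1,2(q-p)}$ for $p,q$ odd, $p<q$; - $\tilde X_{(p,q)}=-Y_{1,2(p-q)}^t$ for $p,q$ even, $p>q$; - $\tilde X_{(p,p+1)}=Z_{2,4}$ for $p$ even, $p<m$; $\tilde X_{(p,q)}=Y_{2,2(q-p)+2}$ for $p$ even, $q$ odd, $q\ge p+3$; - $\tilde X_{(p,p-1)}=-Z_{2,4}^t$ for $p\ge4$ even; $\tilde X_{(p,q)}=-Y_{2,2(p-q)+2}^t$ for $p$ even, $q\ge3$ odd, $p\ge q+3$; - $\tilde X_{(p,q)}=0$ in all other cases.
   Context: $A_n$ is the $n\times n$ matrix with $(A_n)_{i,i+1}=1$ for $1\le i\le n-1$ and zeros elsewhere; $A_n^2$ is its square, so $(A_n^2)_{i,i+2}=1$ for $1\le i\le n-2$ and all other entries are $0$. Index ranges with negative upper bound are empty. *)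

theory Defs
  imports "Jordan_Normal_Form.Matrix" Complex_Main
begin

(* Matrix entries are 0-based in the library; blocks p, q and the parameter indices
   in x i j (standing for x_{i,j}) are 1-based as in the mathematics. *)

definition A_mat :: "nat \<Rightarrow> complex mat" where
  "A_mat n = mat n n (\<lambda>(i, j). if j = i + 1 then 1 else 0)"

definition pad :: "complex mat \<Rightarrow> complex mat" where
  "pad X = four_block_mat (0\<^sub>m 1 1) (0\<^sub>m 1 (dim_col X)) (0\<^sub>m (dim_row X) 1) X"

definition block2 :: "complex mat \<Rightarrow> nat \<Rightarrow> nat \<Rightarrow> complex mat" where
  "block2 M p q = mat 2 2 (\<lambda>(i, j). M $$ (2 * (p - 1) + i, 2 * (q - 1) + j))"

definition mat22 :: "complex \<Rightarrow> complex \<Rightarrow> complex \<Rightarrow> complex \<Rightarrow> complex mat" where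
  "mat22 a b c d = mat_of_rows_list 2 [[a, b], [c, d]]"

definition X11 :: "(nat \<Rightarrow> nat \<Rightarrow> complex) \<Rightarrow> complex mat" where
  "X11 x = mat22 0 0
                 0 (x 1 1)"

definition X21 :: "(nat \<Rightarrow> nat \<Rightarrow> complex) \<Rightarrow> complex mat" where
  "X21 x = mat22 0 (x 2 1)
                 0 0"

definition X22 :: "(nat \<Rightarrow> nat \<Rightarrow> complex) \<Rightarrow> complex mat" where
  "X22 x = mat22 (x 2 2) (x 2 3)
                 0       (- x 1 1)"

definition Z24 :: "(nat \<Rightarrow> nat \<Rightarrow> complex) \<Rightarrow> complex mat" where
  "Z24 x = mat22 (x 2 4)   (x 2 5)
                 (- x 2 1) 0"

definition Y1 :: "(nat \<Rightarrow> nat \<Rightarrow> complex) \<Rightarrow> nat \<Rightarrow> complex mat" where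
  "Y1 x i = mat22 0       0
                  (x 1 i) (x 1 (i + 1))"

definition Y2 :: "(nat \<Rightarrow> nat \<Rightarrow> complex) \<Rightarrow> nat \<Rightarrow> complex mat" where
  "Y2 x j = mat22 (x 2 j) (x 2 (j + 1))
                  0       0"

(* The cases before the final one are mutually exclusive, so their order is immaterial.
   For 1 <= p, q <= m = (n + 1) div 2 with n mod 4 = 3, Y1 is used only at indices
   4, 8, ..., n - 3 and Y2 only at 8, 12, ..., n - 3; other values of x play no role. *)
definition sol_block :: "(nat \<Rightarrow> nat \<Rightarrow> complex) \<Rightarrow> nat \<Rightarrow> nat \<Rightarrow> complex mat" where
  "sol_block x p q =
    (if p = 1 \<and> q = 1 then X11 x
     else if p = 2 \<and> q = 1 then X21 x
     else if even p \<and> q = p then X22 x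
     else if odd p \<and> p \<ge> 3 \<and> q = p then - transpose_mat (X22 x)
     else if odd p \<and> odd q \<and> p < q then Y1 x (2 * (q - p))
     else if even p \<and> even q \<and> p > q then - transpose_mat (Y1 x (2 * (p - q)))
     else if even p \<and> q = p + 1 then Z24 x
     else if even p \<and> odd q \<and> q \<ge> p + 3 then Y2 x (2 * (q - p) + 2)
     else if even p \<and> p \<ge> 4 \<and> p = q + 1 then - transpose_mat (Z24 x)
     else if even p \<and> odd q \<and> q \<ge> 3 \<and> p \<ge> q + 3
       then - transpose_mat (Y2 x (2 * (p - q) + 2))
     else 0\<^sub>m 2 2)"

definition has_sol_form :: "nat \<Rightarrow> (nat \<Rightarrow> nat \<Rightarrow> complex) \<Rightarrow> complex mat \<Rightarrow> bool" where
  "has_sol_form m x M \<longleftrightarrow> (\<forall>p\<in>{1..m}. \<forall>q\<in>{1..m}. block2 M p q = sol_block x p q)"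

end

(* Entrywise the equation says that X vanishes in columns 1, 2 below row 2 and in the last two
   columns above row n - 1, and that X(i+2, j+2) = - X(j, i). The last relation reduces every
   entry to one in the first two rows or columns, so X is determined by its first two rows.
   Applied twice, it makes X constant along diagonals in steps of 4; as n = 3 (mod 4), following
   a diagonal to the right border kills exactly the entries of the first two rows that are not
   parameters. So x_{i,j} is simply X(i, j) for i = 1, 2. *)

theory Submission
  imports Defs
begin

section \<open>The matrix equation as a linear system in the entries\<close>

text \<open>The two summands are the \<open>(i, j)\<close> entries, 0-based, of
  \<open>transpose_mat X * (A_mat n ^\<^sub>m 2)\<close> and of
  \<open>(A_mat n ^\<^sub>m 2) * X\<close>; each guard says whether the shift stays inside the
  matrix.\<close>

definition skew_system :: "nat \<Rightarrow> (nat \<Rightarrow> nat \<Rightarrow> 'a::ab_group_add) \<Rightarrow> bool" where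
  "skew_system n f \<longleftrightarrow> (\<forall>i<n. \<forall>j<n.
     (if 2 \<le> j then f (j - 2) i else 0) + (if i + 2 < n then f (i + 2) j else 0) = 0)"

text \<open>Linearity reduces uniqueness to showing that a solution with vanishing parameters is
  zero.\<close>

lemma skew_system_diff:
  assumes "skew_system n f" and "skew_system n g"
  shows "skew_system n (\<lambda>i j. f i j - g i j)"
proof -
  have "(if P then a - a' else 0) + (if Q then b - b' else 0) =
      ((if P then a else 0) + (if Q then b else 0))
      - ((if P then a' else 0) + (if Q then b' else 0))" for P Q and a a' b b' :: 'a
    by simp
  then show ?thesis
    using assms unfolding skew_system_def by simp
qed

lemma skew_system_cong:
  assumes "\<forall>i<n. \<forall>j<n. f i j = g i j" and "skew_system n g"
  shows "skew_system n f"
proof -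
  \<comment> \<open>Truncated subtraction keeps \<open>j - 2\<close> below n even for
    \<open>j < 2\<close>, so the guard need not be consulted.\<close>
  have "f (j - 2) i = g (j - 2) i" if "i < n" "j < n" for i j
    using assms(1) that by (simp add: less_imp_diff_less)
  then show ?thesis
    using assms unfolding skew_system_def by presburger
qed

lemma A_mat_square: "A_mat n ^\<^sub>m 2 = mat n n (\<lambda>(i, j). if j = i + 2 then 1 else 0)"
proof -
  \<comment> \<open>If \<open>i + 1 \<ge> n\<close>, no k contributes, and \<open>j < n\<close>
    rules out \<open>j = i + 2\<close>, so both sides are 0.\<close>
  have "(\<Sum>k<n. (if k = i + 1 then 1 else 0) * (if j = k + 1 then 1 else (0::complex)))
      = (if j = i + 2 then 1 else 0)" if "j < n" for i j
  proof -
    have "(\<Sum>k<n. (if k = i + 1 then 1 else 0) * (if j = k + 1 then 1 else (0::complex)))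
        = (\<Sum>k<n. if k = i + 1 then (if j = i + 2 then 1 else 0) else 0)"
      by (intro sum.cong) auto
    then show ?thesis
      using that by simp
  qed
  then show ?thesis
    by (intro eq_matI) (auto simp: numeral_2_eq_2 A_mat_def scalar_prod_def atLeast0LessThan)
qed

lemma matrix_equation_iff_skew_system:
  assumes "X \<in> carrier_mat n n"
  shows "transpose_mat X * (A_mat n ^\<^sub>m 2) + (A_mat n ^\<^sub>m 2) * X = 0\<^sub>m n n
    \<longleftrightarrow> skew_system n (\<lambda>i j. X $$ (i, j))"
proof -
  have left: "(\<Sum>k<n. X $$ (k, i) * (if j = k + 2 then 1 else 0))
      = (if 2 \<le> j then X $$ (j - 2, i) else 0)" if "j < n" for i j
  proof -
    have "(\<Sum>k<n. X $$ (k, i) * (if j = k + 2 then 1 else 0))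
        = (\<Sum>k<n. if k = j - 2 then (if 2 \<le> j then X $$ (j - 2, i) else 0) else 0)"
      by (intro sum.cong) auto
    also have "\<dots> = (if 2 \<le> j then X $$ (j - 2, i) else 0)"
      using that by (simp add: less_imp_diff_less)
    finally show ?thesis .
  qed
  have right: "(\<Sum>k<n. (if k = i + 2 then 1 else 0) * X $$ (k, j))
      = (if i + 2 < n then X $$ (i + 2, j) else 0)" for i j
  proof -
    have "(\<Sum>k<n. (if k = i + 2 then 1 else 0) * X $$ (k, j))
        = (\<Sum>k<n. if k = i + 2 then X $$ (i + 2, j) else 0)"
      by (intro sum.cong) auto
    then show ?thesis
      by simp
  qed
  have "(transpose_mat X * (A_mat n ^\<^sub>m 2) + (A_mat n ^\<^sub>m 2) * X) $$ (i, j)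
      = (if 2 \<le> j then X $$ (j - 2, i) else 0) + (if i + 2 < n then X $$ (i + 2, j) else 0)"
    if "i < n" "j < n" for i j
    using that assms left[of j i] right[of i j]
    by (simp add: A_mat_square scalar_prod_def atLeast0LessThan)
  then show ?thesis
    using assms unfolding skew_system_def mat_eq_iff
    by (auto simp: A_mat_square)
qed

section \<open>Vanishing, reflection and periodicity of solutions\<close>

text \<open>For \<open>j < 2\<close> the first summand of the equation at \<open>(i, j)\<close> is
  absent.\<close>

lemma skew_system_below:
  assumes "skew_system n f" "i + 2 < n" "j < 2"
  shows "f (i + 2) j = 0"
  using assms(1)[unfolded skew_system_def, rule_format, of i j] assms(2,3) by simp

text \<open>In the equation at \<open>(i, j + 2)\<close> the second summand is absent because
  \<open>i + 2\<close> leaves the matrix.\<close>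

lemma skew_system_right:
  assumes "skew_system n f" "j + 2 < n" "i < n" "n \<le> i + 2"
  shows "f j i = 0"
  using assms(1)[unfolded skew_system_def, rule_format, of i "j + 2"] assms(2-) by simp

lemma skew_system_reflect:
  assumes "skew_system n f" "i + 2 < n" "j + 2 < n"
  shows "f (i + 2) (j + 2) = - f j i"
  using assms(1)[unfolded skew_system_def, rule_format, of i "j + 2"] assms(2-)
  by (simp add: eq_neg_iff_add_eq_0 add.commute)

lemma skew_system_diagonal:
  assumes "skew_system n f" "i + 4 * k < n" "j + 4 * k < n"
  shows "f (i + 4 * k) (j + 4 * k) = f i j"
  using assms
proof (induction k)
  case (Suc k)
  have "f (i + 4 * Suc k) (j + 4 * Suc k) = f ((i + 4 * k + 2) + 2) ((j + 4 * k + 2) + 2)"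
    by (simp add: algebra_simps numeral_eq_Suc)
  also have "\<dots> = f (i + 4 * k) (j + 4 * k)"
    \<comment> \<open>Each reflection swaps the indices and changes the sign; two of them undo both
      and leave a shift by 4.\<close>
    using Suc.prems skew_system_reflect[of n f "i + 4 * k + 2" "j + 4 * k + 2"]
      skew_system_reflect[of n f "j + 4 * k" "i + 4 * k"] by simp
  finally show ?case
    using Suc by simp
qed simp

lemma skew_system_off_parameters:
  assumes "skew_system n f" "n mod 4 = 3" "i < 2" "j < n" "i < j"
    and "j mod 4 = 1 \<or> j mod 4 = 2" and "i = 1 \<Longrightarrow> 5 \<le> j"
  shows "f i j = 0"
proof -
  \<comment> \<open>The number of steps of 4 that take column j to one of the last two columns, n -
    2 or n - 1 (0-based).\<close>
  define k where "k = n div 4 - j div 4"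
  have nj: "n = 4 * (n div 4) + 3" "j = 4 * (j div 4) + 1 \<or> j = 4 * (j div 4) + 2"
    using assms(2,6) mult_div_mod_eq[of 4 n] mult_div_mod_eq[of 4 j] by linarith+
  have "j div 4 \<le> n div 4"
    using \<open>j < n\<close> by (simp add: div_le_mono)
  then have k: "4 * k + 4 * (j div 4) = 4 * (n div 4)"
    unfolding k_def by simp
  have "j + 4 * k < n \<and> n \<le> j + 4 * k + 2"
    using nj k by linarith
  moreover have "i + 4 * k + 2 < n"
  proof (cases "i = 0")
    case True
    then show ?thesis
      using nj k by linarith
  next
    \<comment> \<open>From row 1 the diagonal must end above row n - 2, that is,
      \<open>k < n div 4\<close>. This holds once \<open>5 \<le> j\<close>; for j = 1, 2 it ends too
      low, and these two entries are the parameters x_{2,2} and x_{2,3}.\<close>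
    case False
    then have "i = 1" "5 \<le> j"
      using assms by auto
    then show ?thesis
      using nj k by linarith
  qed
  ultimately show ?thesis
    using skew_system_diagonal[of n f i k j] skew_system_right[of n f "i + 4 * k" "j + 4 * k"]
      assms(1) by simp
qed

lemma skew_system_eq_0:
  assumes sys: "skew_system n f" and n: "n mod 4 = 3"
    and row0: "\<And>j. j < n \<Longrightarrow> j mod 4 = 0 \<or> j mod 4 = 3 \<Longrightarrow> f 0 j = 0"
    and row1: "\<And>j. j < n \<Longrightarrow> j mod 4 = 0 \<or> j mod 4 = 3 \<or> j = 1 \<or> j = 2 \<Longrightarrow> f 1 j = 0"
    and "i < n" "j < n"
  shows "f i j = 0"
proof -
  have mod4: "j mod 4 = 1 \<or> j mod 4 = 2" if "\<not> (j mod 4 = 0 \<or> j mod 4 = 3)" for j :: nat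
    using that by presburger
  have zero0: "f 0 j = 0" if "j < n" for j
  proof (cases "j mod 4 = 0 \<or> j mod 4 = 3")
    case True
    then show ?thesis
      by (rule row0[OF that])
  next
    case False
    then have "j \<noteq> 0"
      by (intro notI) simp
    then show ?thesis
      using skew_system_off_parameters[OF sys n, of 0 j] mod4[OF False] \<open>j < n\<close> by simp
  qed
  have zero1: "f 1 j = 0" if "j < n" for j
  proof (cases "j mod 4 = 0 \<or> j mod 4 = 3 \<or> j = 1 \<or> j = 2")
    case True
    then show ?thesis
      by (rule row1[OF that])
  next
    case False
    then have "j \<noteq> 0" "j \<noteq> 3" "j \<noteq> 4"
      by (intro notI; simp)+
    moreover have "j \<noteq> 1" "j \<noteq> 2"
      using False by blast+
    ultimately have "5 \<le> j"
      by linarith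
    then show ?thesis
      using skew_system_off_parameters[OF sys n, of 1 j] mod4[of j] False \<open>j < n\<close> by simp
  qed
  show ?thesis
    using \<open>i < n\<close> \<open>j < n\<close>
  \<comment> \<open>Reflection sends \<open>(i, j)\<close> to \<open>(j - 2, i - 2)\<close>, so the
    row index may grow, but the sum of the indices drops by 4.\<close>
  proof (induction "i + j" arbitrary: i j rule: less_induct)
    case less
    consider "i = 0" | "i = 1" | "2 \<le> i" "j < 2" | "2 \<le> i" "2 \<le> j"
      by linarith
    then show ?case
    proof cases
      case 3
      then have "Suc (Suc (i - 2)) = i"
        by simp
      then show ?thesis
        using 3 skew_system_below[OF sys, of "i - 2" j] less.prems by simp
    next
      case 4
      then have "Suc (Suc (i - 2)) = i" "Suc (Suc (j - 2)) = j"
        by simp_all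
      then show ?thesis
        using 4 skew_system_reflect[OF sys, of "i - 2" "j - 2"] less.hyps[of "j - 2" "i - 2"]
          less.prems by simp
    qed (use zero0 zero1 less.prems in auto)
  qed
qed

section \<open>The block form as a solution of the system\<close>

text \<open>Positions are 0-based in the padded matrix. Since padding adds one row and one column,
  for \<open>a, b \<ge> 1\<close> they are also the 1-based positions in X, matching the subscripts
  of the parameters.\<close>

definition sol_entry :: "(nat \<Rightarrow> nat \<Rightarrow> complex) \<Rightarrow> nat \<Rightarrow> nat \<Rightarrow> complex" where
  "sol_entry x a b = sol_block x (a div 2 + 1) (b div 2 + 1) $$ (a mod 2, b mod 2)"

lemma mat22_carrier [simp]:
  "mat22 a b c d \<in> carrier_mat 2 2" "dim_row (mat22 a b c d) = 2" "dim_col (mat22 a b c d) = 2"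
  by (auto simp: mat22_def mat_of_rows_list_def)

lemma mat22_index [simp]:
  "mat22 a b c d $$ (0, 0) = a" "mat22 a b c d $$ (0, Suc 0) = b"
  "mat22 a b c d $$ (Suc 0, 0) = c" "mat22 a b c d $$ (Suc 0, Suc 0) = d"
  by (auto simp: mat22_def mat_of_rows_list_def)

lemmas block_defs = X11_def X21_def X22_def Z24_def Y1_def Y2_def

lemma sol_block_carrier: "sol_block x p q \<in> carrier_mat 2 2"
  by (auto simp: sol_block_def block_defs)

text \<open>With the distance \<open>Suc d\<close> to the diagonal made explicit, the case list
  reduces to parities, apart from the exceptional nearest block.\<close>

lemma sol_block_upper:
  "sol_block x p (p + Suc d) =
    (if odd p then (if odd d then Y1 x (2 * Suc d) else 0\<^sub>m 2 2)
     else if d = 0 then Z24 x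
     else if even d then Y2 x (2 * Suc d + 2) else 0\<^sub>m 2 2)"
proof -
  have "2 \<le> d" if "even d" "d \<noteq> 0"
    using that by presburger
  then show ?thesis
    by (auto simp: sol_block_def)
qed

lemma sol_block_lower:
  assumes "1 \<le> q"
  shows "sol_block x (q + Suc d) q =
    (if q = 1 then (if d = 0 then X21 x else 0\<^sub>m 2 2)
     else if even q then (if odd d then - transpose_mat (Y1 x (2 * Suc d)) else 0\<^sub>m 2 2)
     else if d = 0 then - transpose_mat (Z24 x)
     else if even d then - transpose_mat (Y2 x (2 * Suc d + 2)) else 0\<^sub>m 2 2)"
proof -
  have "2 \<le> d" if "even d" "d \<noteq> 0"
    using that by presburger
  moreover have "3 \<le> q" if "odd q" "q \<noteq> 1"
    using that by presburger
  ultimately show ?thesis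
    using assms by (auto simp: sol_block_def)
qed

text \<open>The reflection in block form, as one block is a shift by 2. The conditions on a and b
  exclude the padding: there \<open>sol_block x q p\<close> has zeros, whereas the shifted block may
  hold parameters, such as the first row of \<open>X22\<close>.\<close>

lemma sol_block_reflect:
  assumes "1 \<le> p" "1 \<le> q" "a < 2" "b < 2" "p = 1 \<Longrightarrow> a = 1" "q = 1 \<Longrightarrow> b = 1"
  shows "sol_block x (p + 1) (q + 1) $$ (a, b) = - sol_block x q p $$ (b, a)"
proof -
  have ab: "a = 0 \<or> a = 1" "b = 0 \<or> b = 1"
    using assms by auto
  consider "p = q" | d where "q = p + Suc d" | d where "p = q + Suc d"
    by (metis less_iff_Suc_add linorder_neqE_nat add_Suc_right)
  then show ?thesis
  proof cases
    case 1
    moreover have "p = 1 \<or> (2 \<le> p \<and> even p) \<or> (3 \<le> p \<and> odd p)"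
      using assms by presburger
    ultimately show ?thesis
      using ab assms by (auto simp: sol_block_def block_defs)
  next
    \<comment> \<open>The two blocks lie on opposite sides of the diagonal at the same distance
      \<open>Suc d\<close>.\<close>
    case 2
    then show ?thesis
      using ab assms sol_block_upper[of x "p + 1" d] sol_block_lower[of p x d]
      by (auto simp: block_defs)
  next
    case 3
    then show ?thesis
      using ab assms sol_block_upper[of x q d] sol_block_lower[of "q + 1" x d]
      by (auto simp: block_defs)
  qed
qed

lemma sol_entry_reflect:
  assumes "1 \<le> a" "1 \<le> b"
  shows "sol_entry x (a + 2) (b + 2) = - sol_entry x b a"
proof -
  have "a div 2 + 1 = 1 \<Longrightarrow> a mod 2 = 1" "b div 2 + 1 = 1 \<Longrightarrow> b mod 2 = 1"
    using assms by presburger+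
  then show ?thesis
    using sol_block_reflect[of "a div 2 + 1" "b div 2 + 1" "a mod 2" "b mod 2" x]
    unfolding sol_entry_def by simp
qed

lemma sol_block_column1:
  assumes "3 \<le> p"
  shows "sol_block x p 1 = 0\<^sub>m 2 2"
  using assms by (auto simp: sol_block_def)

lemma sol_block_column2:
  assumes "r < 2" "3 \<le> p \<or> p = 2 \<and> r = 1"
  shows "sol_block x p 2 $$ (r, 0) = 0"
proof -
  have "r = 0 \<or> r = 1"
    using assms(1) by auto
  then show ?thesis
    using assms(2) by (auto simp: sol_block_def block_defs)
qed

lemma sol_entry_below:
  assumes "3 \<le> a" "b = 1 \<or> b = 2"
  shows "sol_entry x a b = 0"
proof -
  \<comment> \<open>Row 3 is the lower row of block row 2, so there the zeros come from inside
    \<open>X21\<close> and \<open>X22\<close>; later rows lie in block rows from 3 on.\<close>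
  have row: "3 \<le> a div 2 + 1 \<or> a div 2 + 1 = 2 \<and> a mod 2 = 1"
    using assms(1) by presburger
  from assms(2) show ?thesis
  proof
    assume b: "b = 1"
    show ?thesis
    proof (cases "a = 3")
      case True
      then show ?thesis
        using b by (simp add: sol_entry_def sol_block_def block_defs)
    next
      case False
      then have "3 \<le> a div 2 + 1"
        using assms(1) by presburger
      then show ?thesis
        using b sol_block_column1[of "a div 2 + 1" x] by (simp add: sol_entry_def)
    qed
  next
    assume "b = 2"
    then show ?thesis
      using sol_block_column2[OF _ row, of x]
      by (simp add: sol_entry_def del: One_nat_def add: numeral_2_eq_2[symmetric])
  qed
qed

text \<open>As n = 3 (mod 4), the last two columns form a single block column of even index, and
  blocks above the diagonal in an even block column are zero.\<close>

lemma sol_entry_right: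
  assumes "n mod 4 = 3" "a + 2 \<le> n" "b = n \<or> b + 1 = n"
  shows "sol_entry x a b = 0"
proof -
  define k where "k = n div 4"
  have "n = 4 * k + 3"
    using assms(1) unfolding k_def by presburger
  then have "b div 2 + 1 = 2 * (k + 1)" "a div 2 + 1 < 2 * (k + 1)"
    using assms(2,3) by auto
  moreover have "sol_block x p (2 * (k + 1)) = 0\<^sub>m 2 2" if "p < 2 * (k + 1)" for p
    using that by (auto simp: sol_block_def)
  ultimately show ?thesis
    by (simp only: sol_entry_def) simp
qed

lemma skew_system_sol_entry:
  assumes "n mod 4 = 3"
  shows "skew_system n (\<lambda>i j. sol_entry x (Suc i) (Suc j))"
  unfolding skew_system_def
proof (intro allI impI)
  fix i j
  assume ij: "i < n" "j < n"
  \<comment> \<open>\<open>sol_entry\<close> extends beyond the matrix, so reflection needs no bound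
    by n; only the last two columns depend on n.\<close>
  have "sol_entry x (Suc (i + 2)) (Suc j) = - sol_entry x (Suc (j - 2)) (Suc i)" if "2 \<le> j"
  proof -
    have "Suc (Suc (j - 2)) = j"
      using that by simp
    then show ?thesis
      using sol_entry_reflect[of "Suc i" "Suc (j - 2)" x] by simp
  qed
  moreover have "sol_entry x (Suc (i + 2)) (Suc j) = 0" if "\<not> 2 \<le> j"
    using sol_entry_below[of "Suc (i + 2)" "Suc j" x] that by force
  moreover have "sol_entry x (Suc (j - 2)) (Suc i) = 0" if "2 \<le> j" "\<not> i + 2 < n"
    using sol_entry_right[OF assms, of "Suc (j - 2)" "Suc i" x] that ij by force
  ultimately show "(if 2 \<le> j then sol_entry x (Suc (j - 2)) (Suc i) else 0) +
      (if i + 2 < n then sol_entry x (Suc (i + 2)) (Suc j) else 0) = 0"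
    by auto
qed

section \<open>Positions of the parameters, removal of the padding, and the classification\<close>

lemma sol_entry_border: "sol_entry x 0 b = 0" "sol_entry x a 0 = 0"
  by (auto simp: sol_entry_def sol_block_def block_defs mod2_eq_if)

lemma sol_entry_row1:
  assumes "b mod 4 = 0 \<or> b mod 4 = 1" "1 \<le> b"
  shows "sol_entry x 1 b = x 1 b"
proof -
  define k where "k = b div 4"
  \<comment> \<open>Columns 4k and 4k + 1 are the two columns of block \<open>2 * k + 1\<close>, a
    \<open>Y1\<close> block; only b = 1 falls into \<open>X11\<close>.\<close>
  have "b = 1 \<or> 1 \<le> k \<and> (b = 4 * k \<or> b = 4 * k + 1)"
    using assms unfolding k_def by presburger
  moreover have "sol_block x 1 (2 * k + 1) = Y1 x (4 * k)" if "1 \<le> k"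
    using that by (auto simp: sol_block_def)
  moreover have "(4 * k) div 2 = 2 * k" "(4 * k + 1) div 2 = 2 * k"
      "(4 * k) mod 2 = 0" "(4 * k + 1) mod 2 = 1"
    by presburger+
  ultimately show ?thesis
    by (elim disjE conjE) (simp_all add: sol_entry_def sol_block_def block_defs)
qed

lemma sol_entry_row2:
  assumes "b mod 4 = 0 \<or> b mod 4 = 1 \<or> b = 2 \<or> b = 3" "1 \<le> b"
  shows "sol_entry x 2 b = x 2 b"
proof -
  define k where "k = b div 4"
  \<comment> \<open>The columns up to 5 meet the irregular blocks \<open>X21\<close> (b = 1),
    \<open>X22\<close> (b = 2, 3) and \<open>Z24\<close> (b = 4, 5); the \<open>Y2\<close> blocks
    start at k = 2.\<close>
  have "b = 1 \<or> b = 2 \<or> b = 3 \<or> b = 4 \<or> b = 5 \<or> 2 \<le> k \<and> (b = 4 * k \<or> b = 4 * k + 1)"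
  proof -
    have "b = 4 * k \<or> b = 4 * k + 1 \<or> b = 2 \<or> b = 3"
      using assms(1) mult_div_mod_eq[of 4 b] unfolding k_def by linarith
    moreover have "k = 0 \<or> k = 1 \<or> 2 \<le> k"
      by linarith
    ultimately show ?thesis
      using assms(2) by auto
  qed
  moreover have "sol_block x 2 (2 * k + 1) = Y2 x (4 * k)" if "2 \<le> k"
  proof -
    have "2 * (2 * k + 1 - 2) + 2 = 4 * k"
      using that by simp
    then show ?thesis
      using that by (simp add: sol_block_def)
  qed
  moreover have "(4 * k) div 2 = 2 * k" "(4 * k + 1) div 2 = 2 * k"
      "(4 * k) mod 2 = 0" "(4 * k + 1) mod 2 = 1"
    by presburger+
  ultimately show ?thesis
    by (elim disjE conjE) (simp_all add: sol_entry_def sol_block_def block_defs)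
qed

lemma has_sol_form_iff_entries:
  "has_sol_form m x M \<longleftrightarrow> (\<forall>a<2 * m. \<forall>b<2 * m. M $$ (a, b) = sol_entry x a b)"
proof
  assume form: "has_sol_form m x M"
  show "\<forall>a<2 * m. \<forall>b<2 * m. M $$ (a, b) = sol_entry x a b"
  proof (intro allI impI)
    fix a b
    assume "a < 2 * m" "b < 2 * m"
    then have "block2 M (a div 2 + 1) (b div 2 + 1) = sol_block x (a div 2 + 1) (b div 2 + 1)"
      using form unfolding has_sol_form_def by auto
    then have "block2 M (a div 2 + 1) (b div 2 + 1) $$ (a mod 2, b mod 2) = sol_entry x a b"
      unfolding sol_entry_def by simp
    then show "M $$ (a, b) = sol_entry x a b"
      by (simp add: block2_def)
  qed
next
  assume entries: "\<forall>a<2 * m. \<forall>b<2 * m. M $$ (a, b) = sol_entry x a b"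
  show "has_sol_form m x M"
    unfolding has_sol_form_def
  proof (intro ballI eq_matI)
    fix p q i j
    assume pq: "p \<in> {1..m}" "q \<in> {1..m}"
      and "i < dim_row (sol_block x p q)" "j < dim_col (sol_block x p q)"
    then have ij: "i < 2" "j < 2"
      using sol_block_carrier[of x p q] by auto
    then have "2 * (p - 1) + i < 2 * m" "2 * (q - 1) + j < 2 * m"
      using pq by auto
    then show "block2 M p q $$ (i, j) = sol_block x p q $$ (i, j)"
      using entries pq ij by (simp add: block2_def sol_entry_def)
  qed (use sol_block_carrier in \<open>auto simp: block2_def\<close>)
qed

lemma has_sol_form_pad_iff:
  assumes "X \<in> carrier_mat n n" "n + 1 = 2 * m"
  shows "has_sol_form m x (pad X)
    \<longleftrightarrow> (\<forall>i<n. \<forall>j<n. X $$ (i, j) = sol_entry x (Suc i) (Suc j))"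
proof -
  have pad_entry: "pad X $$ (a, b) = (if a = 0 \<or> b = 0 then 0 else X $$ (a - 1, b - 1))"
    if "a < Suc n" "b < Suc n" for a b
    using that assms by (auto simp: pad_def)
  have "has_sol_form m x (pad X)
      \<longleftrightarrow> (\<forall>a<Suc n. \<forall>b<Suc n. pad X $$ (a, b) = sol_entry x a b)"
    using assms(2) by (simp add: has_sol_form_iff_entries)
  also have "\<dots> \<longleftrightarrow> (\<forall>i<n. \<forall>j<n. X $$ (i, j) = sol_entry x (Suc i) (Suc j))"
    by (simp add: pad_entry All_less_Suc2 sol_entry_border)
  finally show ?thesis .
qed

theorem proposition5p11:
  fixes n m :: nat
  assumes "n mod 4 = 3" and "n \<ge> 7" and "m = (n + 1) div 2"
  shows "(\<forall>X \<in> carrier_mat n n.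
            transpose_mat X * (A_mat n ^\<^sub>m 2) + (A_mat n ^\<^sub>m 2) * X = 0\<^sub>m n n
              \<longleftrightarrow> (\<exists>x. has_sol_form m x (pad X)))
       \<and> (\<forall>x. \<exists>X \<in> carrier_mat n n. has_sol_form m x (pad X))"
proof (intro conjI ballI allI)
  have m: "n + 1 = 2 * m"
    using assms by presburger
  fix X :: "complex mat"
  assume X: "X \<in> carrier_mat n n"
  have "(\<exists>x. has_sol_form m x (pad X))" if sys: "skew_system n (\<lambda>i j. X $$ (i, j))"
  proof
    \<comment> \<open>Subtracting 1 turns the 1-based parameter subscripts into matrix
      indices.\<close>
    define x where "x i j = X $$ (i - 1, j - 1)" for i j
    have "X $$ (i, j) - sol_entry x (Suc i) (Suc j) = 0" if "i < n" "j < n" for i j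
    \<comment> \<open>The difference from the block form with these parameters solves the system and
      vanishes at every parameter position, hence everywhere.\<close>
    proof (rule skew_system_eq_0[OF skew_system_diff[OF sys skew_system_sol_entry] _ _ _ that])
      fix j :: nat
      assume "j < n"
      show "X $$ (0, j) - sol_entry x (Suc 0) (Suc j) = 0" if "j mod 4 = 0 \<or> j mod 4 = 3"
      proof -
        have "Suc j mod 4 = 0 \<or> Suc j mod 4 = 1"
          using that by presburger
        then show ?thesis
          using sol_entry_row1[of "Suc j" x] by (simp add: x_def)
      qed
      show "X $$ (1, j) - sol_entry x (Suc 1) (Suc j) = 0"
        if "j mod 4 = 0 \<or> j mod 4 = 3 \<or> j = 1 \<or> j = 2"
      proof -
        have "Suc j mod 4 = 0 \<or> Suc j mod 4 = 1 \<or> Suc j = 2 \<or> Suc j = 3"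
          using that by presburger
        then show ?thesis
          using sol_entry_row2[of "Suc j" x] by (simp add: x_def numeral_2_eq_2)
      qed
    qed (use assms in auto)
    then show "has_sol_form m x (pad X)"
      by (simp add: has_sol_form_pad_iff[OF X m])
  qed
  moreover have "skew_system n (\<lambda>i j. X $$ (i, j))" if "has_sol_form m x (pad X)" for x
    using skew_system_cong[OF that[unfolded has_sol_form_pad_iff[OF X m]]]
      skew_system_sol_entry[OF assms(1), of x] by simp
  ultimately show "transpose_mat X * (A_mat n ^\<^sub>m 2) + (A_mat n ^\<^sub>m 2) * X = 0\<^sub>m n n
      \<longleftrightarrow> (\<exists>x. has_sol_form m x (pad X))"
    using matrix_equation_iff_skew_system[OF X] by blast
next
  fix x
  \<comment> \<open>Freedom of the parameters: stripping the border from the block form gives a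
    matrix for any choice of x.\<close>
  define X where "X = mat n n (\<lambda>(i, j). sol_entry x (Suc i) (Suc j))"
  have X: "X \<in> carrier_mat n n"
    unfolding X_def by simp
  have m: "n + 1 = 2 * m"
    using assms by presburger
  have "has_sol_form m x (pad X)"
    unfolding has_sol_form_pad_iff[OF X m] by (simp add: X_def)
  then show "\<exists>X \<in> carrier_mat n n. has_sol_form m x (pad X)"
    using X by blast
qed

end
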